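(* There exists a planar graph that does not admit a mixed $1$-stack $1$-queue layout.
   Context: Let $G=(V,E)$ be a graph. A vertex ordering is a total order $<$ on $V$. For an edge $e$, let $L(e)<R(e)$ denote its endpoints. Two edges $e,f$ cross if $L(e)<L(f)<R(e)<R(f)$, and nest if $L(e)<L(f)<R(f)<R(e)$. A stack is a set of edges no two of which cross; a queue is a set of edges no two of which nest. A mixed $1$-stack $1$-queue layout of $G$ is a vertex ordering $<$ of $G$ together with a partition of $E$ into a stack $S$ and a queue $Q$ (both with respect to the same ordering $<$). *)

theory Defs
  imports "HOL-Analysis.Analysis"
begin

definition simple_graph :: "'a set \<Rightarrow> 'a set set \<Rightarrow> bool" where
  "simple_graph V E \<longleftrightarrow> finite V \<and>
     (\<forall>e\<in>E. \<exists>u v. u \<in> V \<and> v \<in> V \<and> u \<noteq> v \<and> e = {u, v})"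

definition planar :: "'a set \<Rightarrow> 'a set set \<Rightarrow> bool" where
  "planar V E \<longleftrightarrow>
     (\<exists>(pos :: 'a \<Rightarrow> complex) (c :: 'a set \<Rightarrow> real \<Rightarrow> complex).
        inj_on pos V \<and>
        (\<forall>e\<in>E. arc (c e) \<and>
                 {pathstart (c e), pathfinish (c e)} = pos ` e \<and>
                 path_image (c e) \<inter> pos ` V = pos ` e) \<and>
        (\<forall>e\<in>E. \<forall>f\<in>E. e \<noteq> f \<longrightarrow>
                 path_image (c e) \<inter> path_image (c f) \<subseteq> pos ` (e \<inter> f)))"

definition edges_cross :: "('a \<times> 'a) set \<Rightarrow> 'a set \<Rightarrow> 'a set \<Rightarrow> bool" where
  "edges_cross r e f \<longleftrightarrow> (\<exists>a b c d. e = {a, b} \<and> f = {c, d} \<and>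
      (a, c) \<in> r \<and> (c, b) \<in> r \<and> (b, d) \<in> r)"

definition edges_nest :: "('a \<times> 'a) set \<Rightarrow> 'a set \<Rightarrow> 'a set \<Rightarrow> bool" where
  "edges_nest r e f \<longleftrightarrow> (\<exists>a b c d. e = {a, b} \<and> f = {c, d} \<and>
      (a, c) \<in> r \<and> (c, d) \<in> r \<and> (d, b) \<in> r)"

definition is_stack :: "('a \<times> 'a) set \<Rightarrow> 'a set set \<Rightarrow> bool" where
  "is_stack r S \<longleftrightarrow> (\<forall>e\<in>S. \<forall>f\<in>S. \<not> edges_cross r e f)"

definition is_queue :: "('a \<times> 'a) set \<Rightarrow> 'a set set \<Rightarrow> bool" where
  "is_queue r Q \<longleftrightarrow> (\<forall>e\<in>Q. \<forall>f\<in>Q. \<not> edges_nest r e f)"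

definition has_mixed_1s1q_layout :: "'a set \<Rightarrow> 'a set set \<Rightarrow> bool" where
  "has_mixed_1s1q_layout V E \<longleftrightarrow>
     (\<exists>r S Q. strict_linear_order_on V r \<and> r \<subseteq> V \<times> V \<and>
        S \<union> Q = E \<and> S \<inter> Q = {} \<and> is_stack r S \<and> is_queue r Q)"

end

theory Submission
  imports Defs
begin

text \<open>The graph is a 2-tree: starting from an edge, attach 40 common neighbours to the ends of each edge,
  six times over. In a mixed layout, pigeonhole gives three common neighbours of \<open>A\<close> and \<open>B\<close> in the same
  position relative to \<open>A\<close>, \<open>B\<close> and with the same assignment of edges to stack and queue (there are at most \<open>2\<^sup>4\<close> types, at most 3 vertices
  have to be avoided, and \<open>40 > 3 + 2 \<cdot> 2\<^sup>4\<close>). If these three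
  lie to the right of \<open>A\<close> and \<open>B\<close>, then one of the two edges at each is in the stack and the other in the queue,
  which confines the common neighbours further down so much that two of them give a crossing in the stack
  or a nesting in the queue; the left side is symmetric. So they lie between \<open>A\<close> and \<open>B\<close>, and, say,
  \<open>x\<^sub>1 < x\<^sub>2\<close> are joined to \<open>B\<close> by queue edges. Going down two more levels inside
  \<open>x\<^sub>2\<close>, \<open>B\<close> always ends with a queue edge nested below the edge \<open>x\<^sub>1 B\<close>.\<close>

section \<open>Rich pairs\<close>

text \<open>Says how many levels of the 2-tree construction can be continued from the edge
  \<open>u v\<close>. Nothing asks that the vertices found at different edges be disjoint, so the
  property survives injective relabelling and the addition of edges.\<close>

fun rich :: "('a \<Rightarrow> 'a \<Rightarrow> bool) \<Rightarrow> nat \<Rightarrow> 'a \<Rightarrow> 'a \<Rightarrow> bool" where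
  "rich adj 0 u v \<longleftrightarrow> adj u v"
| "rich adj (Suc k) u v \<longleftrightarrow> adj u v \<and>
     (\<exists>X. finite X \<and> card X = 40 \<and> (\<forall>x\<in>X. rich adj k u x \<and> rich adj k v x))"

lemma rich_adj: "rich adj k u v \<Longrightarrow> adj u v"
  by (cases k) auto

lemma rich_sym:
  assumes "\<And>x y. adj x y \<Longrightarrow> adj y x" "rich adj k u v"
  shows "rich adj k v u"
  using assms by (cases k) auto

lemma rich_SucD: "rich adj (Suc k) u v \<Longrightarrow> rich adj k u v"
proof (induction k arbitrary: u v)
  case (Suc k)
  then show ?case by (metis rich.simps(2))
qed simp

lemma rich_mono: "rich adj k u v \<Longrightarrow> j \<le> k \<Longrightarrow> rich adj j u v"
  by (induction k) (auto simp: le_Suc_eq dest: rich_SucD simp del: rich.simps)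

text \<open>Injectivity keeps the 40 common neighbours distinct. The lemma serves to enlarge the
  edge set, to reverse the order, to pass to ranks and to rename complex vertices as
  naturals.\<close>

lemma rich_map:
  assumes "rich adj k u v" "inj_on f V"
    and "\<And>x y. adj x y \<Longrightarrow> x \<in> V \<and> y \<in> V \<and> adj' (f x) (f y)"
  shows "rich adj' k (f u) (f v)"
  using assms(1)
proof (induction k arbitrary: u v)
  case 0
  then show ?case using assms(3) by simp
next
  case (Suc k)
  then obtain X where X: "finite X" "card X = 40" "\<And>x. x \<in> X \<Longrightarrow> rich adj k u x \<and> rich adj k v x"
    and uv: "adj u v"
    by auto
  have "X \<subseteq> V"
    using X(3) assms(3) rich_adj by (metis subsetI)
  then have "card (f ` X) = 40"
    using X(2) assms(2) by (metis card_image inj_on_subset)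
  then show ?case
    using X(1,3) Suc.IH uv assms(3) by (auto intro!: exI[of _ "f ` X"])
qed

lemma rich_adj_mono:
  assumes "rich adj k u v" "\<And>x y. adj x y \<Longrightarrow> adj' x y"
  shows "rich adj' k u v"
  using rich_map[OF assms(1), of id UNIV adj'] assms(2) by simp

lemma three_alike:
  fixes X Z :: "'a::linorder set" and f :: "'a \<Rightarrow> bool \<times> bool \<times> bool \<times> bool"
  assumes "finite X" "card X = 40" "finite Z" "card Z \<le> 3"
  obtains x y z where "x \<in> X - Z" "y \<in> X - Z" "z \<in> X - Z" "x < y" "y < z" "f x = f y" "f y = f z"
proof -
  let ?Y = "X - Z"
  have fin: "finite ?Y" using assms by simp
  have Y: "card ?Y \<ge> 37"
    using assms diff_card_le_card_Diff[of Z X] by linarith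
  have "card (UNIV :: (bool \<times> bool \<times> bool \<times> bool) set) = 16"
    by (simp add: card_UNIV_bool flip: UNIV_Times_UNIV)
  then have im: "card (f ` ?Y) \<le> 16"
    using card_mono[of "UNIV :: (bool \<times> bool \<times> bool \<times> bool) set" "f ` ?Y"] by simp
  have "\<exists>t. card {x \<in> ?Y. f x = t} \<ge> 3"
  proof (rule ccontr)
    assume "\<not> ?thesis"
    then have le: "card {x \<in> ?Y. f x = t} \<le> 2" for t
      by (metis Suc_le_eq not_le numeral_2_eq_2 numeral_3_eq_3 less_Suc_eq_le)
    have "?Y = (\<Union>t\<in>f ` ?Y. {x \<in> ?Y. f x = t})" by auto
    then have "card ?Y \<le> (\<Sum>t\<in>f ` ?Y. card {x \<in> ?Y. f x = t})"
      using card_UN_le[of "f ` ?Y" "\<lambda>t. {x \<in> ?Y. f x = t}"] fin by simp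
    also have "\<dots> \<le> 2 * card (f ` ?Y)"
      using sum_bounded_above[of "f ` ?Y" "\<lambda>t. card {x \<in> ?Y. f x = t}" 2] le by (simp add: mult.commute)
    finally show False using Y im by linarith
  qed
  then obtain t where "card {x \<in> ?Y. f x = t} \<ge> 3" by blast
  then obtain T where T: "T \<subseteq> {x \<in> ?Y. f x = t}" "card T = 3" "finite T"
    by (meson obtain_subset_with_card_n)
  let ?l = "sorted_list_of_set T"
  have "length ?l = 3" using T by simp
  then obtain x y z where l: "?l = [x, y, z]"
    by (auto simp: numeral_3_eq_3 length_Suc_conv simp del: length_sorted_list_of_set)
  have "sorted_wrt (<) ?l" by simp
  moreover have "set ?l = T" using T by simp
  ultimately show thesis
    using that[of x y z] T(1) l by (auto split: if_splits)
qed

section \<open>Rich pairs in a mixed layout\<close>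

text \<open>Vertices are replaced by their positions in the order. With integer positions, negation
  reverses the order, which yields \<open>left\<close> from \<open>right\<close>.\<close>

locale layout =
  fixes S Q :: "int \<Rightarrow> int \<Rightarrow> bool"
  assumes S_sym: "S x y \<Longrightarrow> S y x"
    and Q_sym: "Q x y \<Longrightarrow> Q y x"
    and irrefl: "\<not> S x x" "\<not> Q x x"
    and stack: "a < c \<Longrightarrow> c < b \<Longrightarrow> b < d \<Longrightarrow> S a b \<Longrightarrow> S c d \<Longrightarrow> False"
    and queue: "a < c \<Longrightarrow> c < d \<Longrightarrow> d < b \<Longrightarrow> Q a b \<Longrightarrow> Q c d \<Longrightarrow> False"
begin

definition adj :: "int \<Rightarrow> int \<Rightarrow> bool" where "adj x y \<longleftrightarrow> S x y \<or> Q x y"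

lemma adj_sym: "adj x y \<Longrightarrow> adj y x"
  using S_sym Q_sym by (auto simp: adj_def)

lemma adj_neq: "adj x y \<Longrightarrow> x \<noteq> y"
  using irrefl by (auto simp: adj_def)

lemma rich_adj_sym: "rich adj k x y \<Longrightarrow> rich adj k y x"
  using rich_sym adj_sym by metis

text \<open>\<open>f\<close> is the type to be shared and \<open>Z\<close> holds vertices to avoid;
  \<open>u\<close> and \<open>v\<close> are avoided automatically, as no vertex is adjacent to
  itself. Uses with fewer than four bits pad \<open>f\<close> with \<open>True\<close>.\<close>

lemma children:
  assumes "rich adj (Suc k) u v" "finite Z" "card Z \<le> 3"
  obtains x y z where "x < y" "y < z" "f x = f y" "f y = (f z :: bool \<times> bool \<times> bool \<times> bool)"
    "{x, y, z} \<inter> (Z \<union> {u, v}) = {}"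
    "\<And>t. t \<in> {x, y, z} \<Longrightarrow> rich adj k u t \<and> rich adj k v t \<and> adj u t \<and> adj v t"
proof -
  obtain X where X: "finite X" "card X = 40" "\<And>x. x \<in> X \<Longrightarrow> rich adj k u x \<and> rich adj k v x"
    using assms(1) by auto
  obtain x y z where "x \<in> X - Z" "y \<in> X - Z" "z \<in> X - Z" "x < y" "y < z" "f x = f y" "f y = f z"
    using three_alike[OF X(1,2) assms(2,3)] by metis
  moreover have "t \<noteq> u \<and> t \<noteq> v \<and> adj u t \<and> adj v t" if "t \<in> X" for t
    using X(3)[OF that] rich_adj adj_neq by metis
  ultimately show thesis using that[of x y z] X(3) by auto
qed

text \<open>Crossing depends only on the cyclic order of the four ends. There \<open>u, v\<close> do
  not separate \<open>x\<close> from \<open>y\<close>, so in the 4-cycle \<open>u x v y\<close> one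
  pair of opposite edges crosses.\<close>

lemma no_SS:
  assumes "x < y" "S u x" "S v x" "S u y" "S v y" "u \<noteq> v"
    "x < u \<longleftrightarrow> y < u" "x < v \<longleftrightarrow> y < v"
  shows False
proof -
  have *: False if prems: "u < v" "S u x" "S v x" "S u y" "S v y"
    "x < u \<longleftrightarrow> y < u" "x < v \<longleftrightarrow> y < v" for u v
  proof -
    have ne: "u \<noteq> x" "v \<noteq> x" "u \<noteq> y" "v \<noteq> y" using prems irrefl by auto
    consider "y < u" | "u < x" "y < v" | "v < x" using assms(1) ne prems by fastforce
    then show False
    proof cases
      case 1 then show False using stack[of x y u v] prems assms(1) S_sym by blast
    next
      case 2 then show False using stack[of u x y v] prems assms(1) S_sym by blast
    next
      case 3 then show False using stack[of u v x y] prems assms(1) S_sym by blast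
    qed
  qed
  show False using *[of u v] *[of v u] assms by (metis linorder_neqE)
qed

text \<open>If \<open>u < v\<close>, then \<open>u y\<close> covers \<open>v x\<close>. For
  \<open>x\<close> and \<open>y\<close> between \<open>u\<close> and \<open>v\<close> the four edges
  need not nest, hence the restriction to one side.\<close>

lemma no_QQ_right:
  assumes "x < y" "Q u x" "Q v x" "Q u y" "Q v y" "u \<noteq> v" "u < x" "v < x"
  shows False
  using queue[of u v x y] queue[of v u x y] assms by (metis linorder_neqE)

text \<open>The stack edge \<open>A x3\<close> blocks stack edges from between \<open>B\<close> and
  \<open>x3\<close> to beyond \<open>x3\<close>; the queue edge \<open>B x3\<close> blocks queue
  edges strictly below it. So, after descending to a pair \<open>x2 b\<close>, a common neighbour
  has both edges of one kind, decided by its side of \<open>x3\<close>, and two alike contradict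
  \<open>no_SS\<close> or \<open>no_QQ_right\<close>.\<close>

lemma right_SQ:
  assumes ord: "A < B" "B < x1" "x1 < x2" "x2 < x3"
    and S: "S A x1" "S A x2" "S A x3" and Q: "Q B x1" "Q B x2" "Q B x3"
    and rich: "rich adj 2 B x2"
  shows False
proof -
  \<comment> \<open>To the left of \<open>B\<close>, a stack edge to \<open>x2\<close> would cross
    \<open>A x3\<close> or \<open>A x1\<close>, and a queue edge would cover
    \<open>B x1\<close>.\<close>
  have nbr: "B < b \<and> b < x3 \<and> S x2 b \<or> x3 < b \<and> Q x2 b"
    if "adj x2 b" "b \<notin> {A, B, x3}" for b
  proof -
    have "b \<noteq> x2" using that adj_neq by blast
    consider "b < A" | "A < b" "b < B" | "B < b" "b < x3" | "x3 < b" using \<open>b \<notin> _\<close> by fastforce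
    then show ?thesis
    proof cases
      case 1
      then show ?thesis using stack[of b A x2 x3] queue[of b B x1 x2] that(1) ord S Q S_sym[of x2 b] Q_sym[of x2 b]
        unfolding adj_def by auto
    next
      case 2
      then show ?thesis using stack[of A b x1 x2] queue[of b B x1 x2] that(1) ord S Q S_sym[of x2 b] Q_sym[of x2 b]
        unfolding adj_def by auto
    next
      case 3
      then have "\<not> Q x2 b"
        using queue[of B b x2 x3] queue[of B x2 b x3] ord Q Q_sym[of x2 b] \<open>b \<noteq> x2\<close> by fastforce
      then show ?thesis using that 3 unfolding adj_def by blast
    next
      case 4
      then have "\<not> S x2 b" using stack[of A x2 x3 b] ord S by auto
      then show ?thesis using that 4 unfolding adj_def by blast
    qed
  qed
  have "rich adj (Suc 1) B x2" using rich by (simp add: numeral_2_eq_2)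
  then obtain b b' where b: "b < b'" "{b, b'} \<inter> {A, x3, B, x2} = {}"
    "\<And>t. t \<in> {b, b'} \<Longrightarrow> rich adj 1 x2 t \<and> adj B t \<and> adj x2 t"
    by (rule children[of 1 B x2 "{A, x3}" "\<lambda>_. (True, True, True, True)"]) (auto simp: card_insert_if)
  \<comment> \<open>Otherwise \<open>b\<close> and \<open>b'\<close> are beyond \<open>x3\<close>,
    where stack edges from \<open>B\<close> would cross \<open>A x3\<close>; all four edges to
    \<open>B\<close> and \<open>x2\<close> would be queue edges.\<close>
  have "b < x3"
  proof (rule ccontr)
    assume "\<not> b < x3"
    then have gt: "x3 < b" "x3 < b'" using b by auto
    then have "Q x2 b" "Q x2 b'" using nbr[of b] nbr[of b'] b ord by auto
    moreover have "Q B t" if "t \<in> {b, b'}" for t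
      using stack[of A B x3 t] S ord gt that b(3)[OF that] unfolding adj_def by auto
    ultimately show False using no_QQ_right[of b b' B x2] ord b gt by simp
  qed
  then have bB: "B < b" using nbr[of b] b by auto
  \<comment> \<open>The pair \<open>x2 b\<close> replaces \<open>B x2\<close> because edges ending
    at \<open>B\<close> are not strictly below \<open>B x3\<close>.\<close>
  have "rich adj (Suc 0) x2 b" using b by simp
  then obtain c c' where c: "c < c'" "c < x3 \<longleftrightarrow> c' < x3" "c < b \<longleftrightarrow> c' < b" "c < x2 \<longleftrightarrow> c' < x2"
    "{c, c'} \<inter> {A, B, x3, x2, b} = {}"
    "\<And>t. t \<in> {c, c'} \<Longrightarrow> adj x2 t \<and> adj b t"
    by (rule children[of 0 x2 b "{A, B, x3}" "\<lambda>c. (c < x3, c < b, c < x2, True)"]) (auto simp: card_insert_if)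
  show False
  proof (cases "c < x3")
    case True
    have "S x2 t \<and> S b t" if "t \<in> {c, c'}" for t
    proof -
      have t: "t < x3" "t \<notin> {A, B, x3, b}" using that True c by auto
      have "B < t" "S x2 t" using nbr[of t] c(6)[OF that] t by auto
      moreover have "\<not> Q b t"
        using queue[of B b t x3] queue[of B t b x3] t bB Q Q_sym[of b t] \<open>b < x3\<close> \<open>B < t\<close>
        by fastforce
      ultimately show ?thesis using c(6)[OF that] unfolding adj_def by blast
    qed
    then show False using no_SS[of c c' x2 b] c b by auto
  next
    case False
    have "Q x2 t \<and> Q b t" if "t \<in> {c, c'}" for t
    proof -
      have t: "x3 < t" "t \<notin> {A, B, x3, b}" using that False c by auto
      have "Q x2 t" using nbr[of t] c(6)[OF that] t by auto
      moreover have "\<not> S b t" using stack[of A b x3 t] t bB S \<open>b < x3\<close> ord by auto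
      ultimately show ?thesis using c(6)[OF that] unfolding adj_def by blast
    qed
    then show False using no_QQ_right[of c c' x2 b] c b False ord \<open>b < x3\<close> by auto
  qed
qed

text \<open>Now the queue edge \<open>A x3\<close> forces edges strictly below it into the stack,
  and the stack edge \<open>B x3\<close> forces edges from \<open>x2\<close> past \<open>x3\<close>
  into the queue. Common neighbours past \<open>x3\<close> with stack edges to \<open>B\<close> form
  the configuration of \<open>right_SQ\<close> over the base \<open>B x2\<close>, which costs one
  more level.\<close>

lemma right_QS:
  assumes ord: "A < B" "B < x1" "x1 < x2" "x2 < x3"
    and Q: "Q A x1" "Q A x2" "Q A x3" and S: "S B x1" "S B x2" "S B x3"
    and rich: "rich adj 3 B x2"
  shows False
proof -
  have "rich adj (Suc 2) B x2" using rich by (simp add: numeral_3_eq_3 numeral_2_eq_2)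
  then obtain y1 y2 y3 where y: "y1 < y2" "y2 < y3"
    "y1 < x3 \<longleftrightarrow> y2 < x3" "y1 < x2 \<longleftrightarrow> y2 < x2" "S B y1 \<longleftrightarrow> S B y2"
    "y2 < x3 \<longleftrightarrow> y3 < x3" "y2 < x2 \<longleftrightarrow> y3 < x2" "S B y2 \<longleftrightarrow> S B y3"
    "{y1, y2, y3} \<inter> {A, x3, B, x2} = {}"
    "\<And>t. t \<in> {y1, y2, y3} \<Longrightarrow> rich adj 2 x2 t \<and> adj B t \<and> adj x2 t"
    by (rule children[of 2 B x2 "{A, x3}" "\<lambda>y. (y < x3, y < x2, S B y, True)"]) (auto simp: card_insert_if)
  have nbr: "B < t \<and> t < x3 \<and> S x2 t \<and> S B t \<or> x3 < t \<and> Q x2 t" if t: "t \<in> {y1, y2, y3}" for t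
  proof -
    have ne: "t \<notin> {A, x3, B, x2}" using t y(9) by auto
    have a: "adj B t" "adj x2 t" using y(10)[OF t] by auto
    consider "t < A" | "A < t" "t < B" | "B < t" "t < x3" | "x3 < t" using ne by fastforce
    then show ?thesis
    proof cases
      case 1
      then show ?thesis using stack[of t B x2 x3] queue[of t A x1 x2] a ord S Q S_sym[of x2 t] Q_sym[of x2 t]
        unfolding adj_def by auto
    next
      case 2
      then show ?thesis using stack[of t B x2 x3] queue[of A t x2 x3] a ord S Q S_sym[of x2 t] Q_sym[of x2 t]
        unfolding adj_def by auto
    next
      case 3
      have "\<not> Q x2 t"
        using queue[of A x2 t x3] queue[of A t x2 x3] 3 ord Q Q_sym[of x2 t] ne by fastforce
      moreover have "\<not> Q B t" using queue[of A B t x3] 3 ord Q by auto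
      ultimately show ?thesis using a 3 unfolding adj_def by blast
    next
      case 4
      then have "\<not> S x2 t" using stack[of B x2 x3 t] ord S by auto
      then show ?thesis using a 4 unfolding adj_def by blast
    qed
  qed
  show False
  proof (cases "y1 < x3")
    case True
    then show False using no_SS[of y1 y2 B x2] nbr[of y1] nbr[of y2] y ord by auto
  next
    case False
    then have Qx: "x3 < y1" "Q x2 y1" "Q x2 y2" "Q x2 y3"
      using nbr[of y1] nbr[of y2] nbr[of y3] y by auto
    show False
    proof (cases "S B y1")
      case True
      then show False
        using right_SQ[of B x2 y1 y2 y3] Qx y ord by auto
    next
      case False
      then have "Q B y1" "Q B y2" using y(5) y(10)[of y1] y(10)[of y2] unfolding adj_def by auto
      then show False using no_QQ_right[of y1 y2 B x2] Qx y ord by auto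
    qed
  qed
qed

lemma right:
  assumes "A \<noteq> B" "A < x1" "B < x1" "x1 < x2" "x2 < x3"
    and "S A x1 \<longleftrightarrow> S A x2" "S A x2 \<longleftrightarrow> S A x3" "S B x1 \<longleftrightarrow> S B x2" "S B x2 \<longleftrightarrow> S B x3"
    and "\<And>t. t \<in> {x1, x2, x3} \<Longrightarrow> rich adj 3 A t \<and> rich adj 3 B t"
  shows False
proof -
  have *: False if "A < B" "B < x1" 
    and same: "S A x1 \<longleftrightarrow> S A x2" "S A x2 \<longleftrightarrow> S A x3" "S B x1 \<longleftrightarrow> S B x2" "S B x2 \<longleftrightarrow> S B x3"
    and r: "\<And>t. t \<in> {x1, x2, x3} \<Longrightarrow> rich adj 3 A t \<and> rich adj 3 B t" for A B
  proof -
    have adj: "adj A t \<and> adj B t" if "t \<in> {x1, x2, x3}" for t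
      using r[OF that] rich_adj by metis
    consider "S A x1" "S B x1" | "S A x1" "\<not> S B x1" | "\<not> S A x1" "S B x1" | "\<not> S A x1" "\<not> S B x1"
      by blast
    then show False
    proof cases
      case 1
      then show False using no_SS[of x1 x2 A B] that assms(4) by auto
    next
      case 2
      then show False
        using right_SQ[of A B x1 x2 x3] rich_mono[of adj 3 B x2 2] r adj same assms(4,5) that(1,2)
        by (auto simp: adj_def)
    next
      case 3
      then show False
        using right_QS[of A B x1 x2 x3] r adj same assms(4,5) that(1,2) by (auto simp: adj_def)
    next
      case 4
      then show False
        using no_QQ_right[of x1 x2 A B] adj same assms(4,5) that(1,2) by (auto simp: adj_def)
    qed
  qed
  show False
    using *[of A B] *[of B A] assms by (metis linorder_neqE)
qed

lemma reflect: "layout (\<lambda>x y. S (- x) (- y)) (\<lambda>x y. Q (- x) (- y))"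
proof
  fix a b c d :: int
  assume "a < c" "c < b" "b < d" "S (- a) (- b)" "S (- c) (- d)"
  then show False using stack[of "- d" "- b" "- c" "- a"] S_sym by simp
next
  fix a b c d :: int
  assume "a < c" "c < d" "d < b" "Q (- a) (- b)" "Q (- c) (- d)"
  then show False using queue[of "- b" "- d" "- c" "- a"] Q_sym by simp
qed (use S_sym Q_sym irrefl in auto)

lemma left:
  assumes "A \<noteq> B" "x1 < x2" "x2 < x3" "x3 < A" "x3 < B"
    and "S A x1 \<longleftrightarrow> S A x2" "S A x2 \<longleftrightarrow> S A x3" "S B x1 \<longleftrightarrow> S B x2" "S B x2 \<longleftrightarrow> S B x3"
    and r: "\<And>t. t \<in> {x1, x2, x3} \<Longrightarrow> rich adj 3 A t \<and> rich adj 3 B t"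
  shows False
proof -
  interpret neg: layout "\<lambda>x y. S (- x) (- y)" "\<lambda>x y. Q (- x) (- y)"
    by (rule reflect)
  have "rich neg.adj 3 (- u) (- v)" if "rich adj 3 u v" for u v
    by (rule rich_map[OF that, of uminus UNIV]) (auto simp: adj_def neg.adj_def inj_on_def)
  then show False
    using neg.right[of "- A" "- B" "- x3" "- x2" "- x1"] assms by auto
qed

text \<open>\<open>right\<close> and \<open>left\<close> exclude positions outside the interval, at
  the price of three levels. By \<open>no_SS\<close> the alike vertices cannot have stack edges to
  both ends, so to one end all three have queue edges.\<close>

lemma middle:
  assumes "rich adj (Suc k) A B" "3 \<le> k" "A < B"
  obtains x1 x2 x3 where "A < x1" "x1 < x2" "x2 < x3" "x3 < B"
    "Q A x1 \<and> Q A x2 \<and> Q A x3 \<or> Q x1 B \<and> Q x2 B \<and> Q x3 B"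
    "\<And>t. t \<in> {x1, x2, x3} \<Longrightarrow> rich adj k A t \<and> rich adj k t B"
proof -
  obtain x1 x2 x3 where x: "x1 < x2" "x2 < x3"
    "x1 < A \<longleftrightarrow> x2 < A" "x1 < B \<longleftrightarrow> x2 < B" "S A x1 \<longleftrightarrow> S A x2" "S B x1 \<longleftrightarrow> S B x2"
    "x2 < A \<longleftrightarrow> x3 < A" "x2 < B \<longleftrightarrow> x3 < B" "S A x2 \<longleftrightarrow> S A x3" "S B x2 \<longleftrightarrow> S B x3"
    "{x1, x2, x3} \<inter> {A, B} = {}"
    "\<And>t. t \<in> {x1, x2, x3} \<Longrightarrow> rich adj k A t \<and> rich adj k B t \<and> adj A t \<and> adj B t"
    by (rule children[OF assms(1), of "{}" "\<lambda>x. (x < A, x < B, S A x, S B x)"]) auto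
  have r3: "rich adj 3 A t \<and> rich adj 3 B t" if "t \<in> {x1, x2, x3}" for t
    using x(12)[OF that] rich_mono assms(2) by metis
  have "\<not> x1 < A"
  proof
    assume "x1 < A"
    then show False using left[of A B x1 x2 x3] x r3 assms(3) by auto
  qed
  moreover have "x1 < B"
  proof (rule ccontr)
    assume "\<not> x1 < B"
    then have "B < x1" using x by auto
    then show False using right[of A B x1 x2 x3] x r3 assms(3) by auto
  qed
  ultimately have mid: "A < x1" "x3 < B" using x by auto
  moreover have "\<not> (S A x1 \<and> S B x1)"
    using no_SS[of x1 x2 A B] x assms(3) by auto
  then have "Q A x1 \<and> Q A x2 \<and> Q A x3 \<or> Q x1 B \<and> Q x2 B \<and> Q x3 B"
    using x Q_sym unfolding adj_def by blast
  ultimately show thesis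
    using that[of x1 x2 x3] x rich_adj_sym by blast
qed

text \<open>The depth is 3 + 3: three nested uses of \<open>middle\<close>, the last of which must
  still leave three levels for \<open>right\<close> and \<open>left\<close>.\<close>

lemma not_rich: "\<not> rich adj 6 u v"
proof
  have False if r: "rich adj 6 A B" and "A < B" for A B
  proof -
    have "rich adj (Suc 5) A B" using r by simp
    then obtain x1 x2 x3 where x: "A < x1" "x1 < x2" "x2 < x3" "x3 < B"
      "Q A x1 \<and> Q A x2 \<and> Q A x3 \<or> Q x1 B \<and> Q x2 B \<and> Q x3 B"
      and xr: "rich adj 5 A x2" "rich adj 5 x2 B"
      by (rule middle) (use \<open>A < B\<close> in auto)
    from x(5) show False
    proof
      assume q: "Q A x1 \<and> Q A x2 \<and> Q A x3"
      \<comment> \<open>Edges at \<open>A\<close> do not nest below \<open>A x3\<close>, so the pair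
        \<open>A x2\<close> is first replaced by \<open>y x2\<close>; then \<open>y z\<close> and
        \<open>z x2\<close> are both strictly below \<open>A x3\<close>.\<close>
      have "rich adj (Suc 4) A x2" using xr by simp
      then obtain y where y: "A < y" "y < x2" "rich adj 4 y x2"
        by (rule middle) (use x in auto)
      have "rich adj (Suc 3) y x2" using y by simp
      then obtain z where "y < z" "z < x2" "Q y z \<or> Q z x2"
        by (rule middle) (use y in auto)
      then show False
        using queue[of A y z x3] queue[of A z x2 x3] q x y by auto
    next
      assume q: "Q x1 B \<and> Q x2 B \<and> Q x3 B"
      have "rich adj (Suc 4) x2 B" using xr by simp
      then obtain y where y: "x2 < y" "y < B" "rich adj 4 x2 y"
        by (rule middle) (use x in auto)
      have "rich adj (Suc 3) x2 y" using y by simp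
      then obtain z where "x2 < z" "z < y" "Q x2 z \<or> Q z y"
        by (rule middle) (use y in auto)
      then show False
        using queue[of x1 x2 z B] queue[of x1 z y B] q x y by auto
    qed
  qed
  moreover assume "rich adj 6 u v"
  ultimately show False
    using rich_adj_sym rich_adj adj_neq by (metis linorder_neqE)
qed

end

section \<open>Straight-line drawings of rich pairs\<close>

text \<open>Vertices are the points themselves, so an edge is drawn as its own convex hull.
  \<open>R\<close> is an enclosing region, kept for gluing drawings together.\<close>

definition drawing :: "complex set \<Rightarrow> complex set set \<Rightarrow> complex set \<Rightarrow> bool" where
  "drawing V E R \<longleftrightarrow> finite V \<and> V \<subseteq> R \<and>
     (\<forall>e\<in>E. \<exists>u v. u \<in> V \<and> v \<in> V \<and> u \<noteq> v \<and> e = {u, v}) \<and>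
     (\<forall>e\<in>E. convex hull e \<subseteq> R \<and> convex hull e \<inter> V \<subseteq> e) \<and>
     (\<forall>e\<in>E. \<forall>f\<in>E. e \<noteq> f \<longrightarrow> convex hull e \<inter> convex hull f \<subseteq> e \<inter> f)"

lemma drawingD:
  assumes "drawing V E R"
  shows "finite V" "V \<subseteq> R"
    "e \<in> E \<Longrightarrow> \<exists>u v. u \<in> V \<and> v \<in> V \<and> u \<noteq> v \<and> e = {u, v}"
    "e \<in> E \<Longrightarrow> convex hull e \<subseteq> R"
    "e \<in> E \<Longrightarrow> convex hull e \<inter> V \<subseteq> e"
    "e \<in> E \<Longrightarrow> f \<in> E \<Longrightarrow> e \<noteq> f \<Longrightarrow> convex hull e \<inter> convex hull f \<subseteq> e \<inter> f"
  using assms unfolding drawing_def by simp_all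

lemma drawing_mono:
  assumes "drawing V E R" "R \<subseteq> R'"
  shows "drawing V E R'"
proof -
  have "V \<subseteq> R'" "\<And>e. e \<in> E \<Longrightarrow> convex hull e \<subseteq> R'"
    using drawingD(2,4)[OF assms(1)] assms(2) by (blast dest: subset_trans)+
  then show ?thesis
    using drawingD(1,3,5,6)[OF assms(1)] unfolding drawing_def by simp
qed

text \<open>A point of an edge of piece \<open>i\<close> that lies in another region is, by
  \<open>meet\<close>, a vertex of piece \<open>i\<close>, and hence an end of that edge.\<close>

lemma drawing_UN:
  assumes "finite I" and dr: "\<And>i. i \<in> I \<Longrightarrow> drawing (V i) (E i) (R i)"
    and meet: "\<And>i j. i \<in> I \<Longrightarrow> j \<in> I \<Longrightarrow> i \<noteq> j \<Longrightarrow> R i \<inter> R j \<subseteq> V i"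
  shows "drawing (\<Union>i\<in>I. V i) (\<Union>i\<in>I. E i) (\<Union>i\<in>I. R i)"
proof -
  have fin: "finite (V i)" and VR: "V i \<subseteq> R i"
    and ends: "e \<in> E i \<Longrightarrow> \<exists>u v. u \<in> V i \<and> v \<in> V i \<and> u \<noteq> v \<and> e = {u, v}"
    and ER: "e \<in> E i \<Longrightarrow> convex hull e \<subseteq> R i"
    and EV: "e \<in> E i \<Longrightarrow> convex hull e \<inter> V i \<subseteq> e"
    and EE: "e \<in> E i \<Longrightarrow> f \<in> E i \<Longrightarrow> e \<noteq> f \<Longrightarrow> convex hull e \<inter> convex hull f \<subseteq> e \<inter> f"
    if "i \<in> I" for i e f
    using drawingD[OF dr[OF that]] by simp_all
  have EV': "convex hull e \<inter> R j \<subseteq> e" if "i \<in> I" "j \<in> I" "i \<noteq> j" "e \<in> E i" for i j e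
    using meet[OF that(1-3)] ER[OF that(1,4)] EV[OF that(1,4)] by blast
  have EVU: "convex hull e \<inter> V j \<subseteq> e" if "i \<in> I" "j \<in> I" "e \<in> E i" for i j e
    using EV[OF that(1,3)] EV'[OF that(1,2) _ that(3)] VR[OF that(2)] by (cases "i = j") auto
  have EEU: "convex hull e \<inter> convex hull f \<subseteq> e \<inter> f"
    if "i \<in> I" "j \<in> I" "e \<in> E i" "f \<in> E j" "e \<noteq> f" for i j e f
  proof (cases "i = j")
    case True
    then show ?thesis using EE that by blast
  next
    case False
    then show ?thesis
      using EV'[OF that(1,2) _ that(3)] EV'[OF that(2,1) _ that(4)] ER[OF that(1,3)] ER[OF that(2,4)]
      by blast
  qed
  show ?thesis
    unfolding drawing_def
  proof (intro conjI ballI impI)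
    show "finite (\<Union>i\<in>I. V i)" using \<open>finite I\<close> fin by simp
    show "(\<Union>i\<in>I. V i) \<subseteq> (\<Union>i\<in>I. R i)" using VR by (rule UN_mono[OF order_refl])
    fix e assume "e \<in> (\<Union>i\<in>I. E i)"
    then obtain i where i: "i \<in> I" "e \<in> E i" by blast
    show "\<exists>u v. u \<in> (\<Union>i\<in>I. V i) \<and> v \<in> (\<Union>i\<in>I. V i) \<and> u \<noteq> v \<and> e = {u, v}"
      using ends[OF i] i(1) by (metis UN_I)
    show "convex hull e \<subseteq> (\<Union>i\<in>I. R i)" using ER[OF i] i(1) by auto
    show "convex hull e \<inter> (\<Union>i\<in>I. V i) \<subseteq> e"
    proof
      fix z assume "z \<in> convex hull e \<inter> (\<Union>i\<in>I. V i)"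
      then obtain j where "j \<in> I" "z \<in> convex hull e \<inter> V j" by auto
      then show "z \<in> e" using EVU[OF i(1) _ i(2)] by (meson subsetD)
    qed
    fix f assume "f \<in> (\<Union>i\<in>I. E i)" and ne: "e \<noteq> f"
    then obtain j where j: "j \<in> I" "f \<in> E j" by blast
    show "convex hull e \<inter> convex hull f \<subseteq> e \<inter> f" by (rule EEU[OF i(1) j(1) i(2) j(2) ne])
  qed
qed

section \<open>Barycentric coordinates and the cells of a triangle\<close>

definition det2 :: "complex \<Rightarrow> complex \<Rightarrow> real" where
  "det2 u v = Re u * Im v - Im u * Re v"

abbreviation nondegenerate :: "complex \<Rightarrow> complex \<Rightarrow> complex \<Rightarrow> bool" where
  "nondegenerate p q r \<equiv> det2 (q - p) (r - p) \<noteq> 0"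

definition bary :: "complex \<Rightarrow> complex \<Rightarrow> complex \<Rightarrow> real \<Rightarrow> real \<Rightarrow> real \<Rightarrow> complex" where
  "bary p q r a b c = a *\<^sub>R p + b *\<^sub>R q + c *\<^sub>R r"

lemma bary_unique:
  assumes "nondegenerate p q r" "bary p q r a b c = bary p q r a' b' c'"
    and "a + b + c = 1" "a' + b' + c' = 1"
  shows "a = a' \<and> b = b' \<and> c = c'"
proof -
  \<comment> \<open>Cramer's rule: determinants against the sides recover the last two
    coordinates.\<close>
  have coords: "det2 (bary p q r x y z - p) (r - p) = y * det2 (q - p) (r - p) \<and>
      det2 (q - p) (bary p q r x y z - p) = z * det2 (q - p) (r - p)" if "x + y + z = 1" for x y z
  proof -
    have x: "x = 1 - y - z" using that by simp
    show ?thesis unfolding x bary_def det2_def by (simp add: algebra_simps)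
  qed
  show ?thesis
    using coords[OF assms(3)] coords[OF assms(4)] assms by auto
qed

lemma bary_swap: "bary q p r b a c = bary p q r a b c"
  by (simp add: bary_def)

lemma nondegenerate_swap: "nondegenerate p q r \<Longrightarrow> nondegenerate q p r"
  by (simp add: det2_def algebra_simps)

text \<open>The triangle \<open>p q r\<close> without its sides \<open>p r\<close> and \<open>q r\<close>, except for \<open>p\<close> and \<open>q\<close>: dropping
  these sides keeps adjacent copies from sharing anything but vertices.\<close>

definition region :: "complex \<Rightarrow> complex \<Rightarrow> complex \<Rightarrow> complex set" where
  "region p q r = {p, q} \<union> {bary p q r a b c | a b c. 0 < a \<and> 0 < b \<and> 0 \<le> c \<and> a + b + c = 1}"

definition median :: "complex \<Rightarrow> complex \<Rightarrow> complex \<Rightarrow> real \<Rightarrow> complex" where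
  "median p q r h = bary p q r ((1 - h) / 2) ((1 - h) / 2) h"

text \<open>In the coordinates \<open>x = a - b\<close>, \<open>y = c\<close>, where \<open>p\<close>, \<open>q\<close>, \<open>r\<close> are \<open>(1,0)\<close>, \<open>(-1,0)\<close>,
  \<open>(0,1)\<close>, the last two inequalities bound the slope \<open>y / (1 - x)\<close> seen from \<open>p\<close>.\<close>

definition in_cell :: "real \<Rightarrow> real \<Rightarrow> real \<Rightarrow> real \<Rightarrow> real \<Rightarrow> bool" where
  "in_cell h' h a b c \<longleftrightarrow> a + b + c = 1 \<and> (b = 0 \<and> c = 0 \<or>
     b \<le> a \<and> 0 < b \<and> 0 < c \<and> (a = b \<longrightarrow> c = h) \<and> h' * (2 * b + c) < c \<and> c \<le> h * (2 * b + c))"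

text \<open>For \<open>0 < h' < h < 1\<close> this is the triangle with corners \<open>p\<close>,
  \<open>median p q r h\<close> and \<open>median p q r h'\<close>, without its sides at slope
  \<open>h'\<close> and on the median, except for \<open>p\<close> and
  \<open>median p q r h\<close>. In \<open>in_cell\<close>, \<open>2 * b + c\<close> is
  \<open>1 - x\<close>.\<close>

definition cell :: "complex \<Rightarrow> complex \<Rightarrow> complex \<Rightarrow> real \<Rightarrow> real \<Rightarrow> complex set" where
  "cell p q r h' h = {bary p q r a b c | a b c. in_cell h' h a b c}"

text \<open>A convex combination with weights \<open>a\<close>, \<open>b\<close>, \<open>c\<close>
  has slope \<open>(b * h + c * h') / (b + c)\<close> seen from \<open>p\<close>: a mean of
  \<open>h\<close> and \<open>h'\<close> giving positive weight to \<open>h\<close>.\<close>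

lemma region_subset_cell:
  assumes "0 < h'" "h' < h" "h < 1"
  shows "region p (median p q r h) (median p q r h') \<subseteq> cell p q r h' h"
proof
  fix z assume "z \<in> region p (median p q r h) (median p q r h')"
  then consider "z = p" | "z = median p q r h"
    | a b c where "z = bary p (median p q r h) (median p q r h') a b c"
      "0 < a" "0 < b" "0 \<le> c" "a + b + c = 1"
    unfolding region_def by auto
  then show "z \<in> cell p q r h' h"
  proof cases
    case 1
    then have "z = bary p q r 1 0 0" by (simp add: bary_def)
    moreover have "in_cell h' h 1 0 0" by (simp add: in_cell_def)
    ultimately show ?thesis unfolding cell_def by blast
  next
    case 2
    have "in_cell h' h ((1 - h) / 2) ((1 - h) / 2) h"
      using assms by (simp add: in_cell_def field_simps)
    then show ?thesis unfolding 2 median_def cell_def by blast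
  next
    case (3 a b c)
    \<comment> \<open>\<open>m\<close> is the resulting weight of \<open>q\<close>; that of
      \<open>p\<close> is \<open>a + m\<close>.\<close>
    define m where "m = (b * (1 - h) + c * (1 - h')) / 2"
    have m: "2 * m + (b * h + c * h') = b + c" unfolding m_def by (simp add: field_simps)
    have "z = bary p q r (a + m) m (b * h + c * h')"
      unfolding 3 median_def bary_def m_def by (simp add: algebra_simps scaleR_conv_of_real add_divide_distrib diff_divide_distrib)
    moreover have "in_cell h' h (a + m) m (b * h + c * h')"
    proof -
      have "0 < b * (1 - h)" "0 \<le> c * (1 - h')" "0 < b * h" "0 \<le> c * h'" using 3 assms by auto
      moreover have "b * h' < b * h" "c * h' \<le> c * h" using 3 assms by (auto intro: mult_left_mono)
      ultimately show ?thesis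
        unfolding in_cell_def m using 3 m
        by (simp add: m_def) (simp add: field_simps)
    qed
    ultimately show ?thesis unfolding cell_def by blast
  qed
qed

lemma cell_subset_region: "cell p q r h' h \<subseteq> region p q r"
proof
  fix z assume "z \<in> cell p q r h' h"
  then obtain a b c where z: "z = bary p q r a b c" "in_cell h' h a b c"
    unfolding cell_def by blast
  show "z \<in> region p q r"
  proof (cases "b = 0")
    case True
    then have "z = p" using z by (auto simp: in_cell_def bary_def)
    then show ?thesis by (simp add: region_def)
  next
    case False
    then have "0 < a \<and> 0 < b \<and> 0 \<le> c \<and> a + b + c = 1" using z(2) by (auto simp: in_cell_def)
    then show ?thesis using z(1) unfolding region_def by blast
  qed
qed

lemma region_swap: "region q p r = region p q r"
proof -
  have "region q p r \<subseteq> region p q r" for p q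
  proof
    fix z assume "z \<in> region q p r"
    then consider "z \<in> {p, q}" | a b c where "z = bary q p r a b c" "0 < a" "0 < b" "0 \<le> c" "a + b + c = 1"
      unfolding region_def by blast
    then show "z \<in> region p q r"
    proof cases
      case 2
      then have "z = bary p q r b a c \<and> 0 < b \<and> 0 < a \<and> 0 \<le> c \<and> b + a + c = 1"
        by (simp add: bary_swap add.commute)
      then show ?thesis unfolding region_def by blast
    qed (auto simp: region_def)
  qed
  then show ?thesis by blast
qed

text \<open>The slope ranges, open at \<open>h1'\<close>, \<open>h2'\<close> and closed at
  \<open>h1\<close>, \<open>h2\<close>, are disjoint, which leaves only \<open>p\<close>.\<close>

lemma cell_meet_same_side:
  assumes "nondegenerate p q r" "h1 \<le> h2'"
  shows "cell p q r h1' h1 \<inter> cell p q r h2' h2 \<subseteq> {p}"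
proof
  fix z assume "z \<in> cell p q r h1' h1 \<inter> cell p q r h2' h2"
  then obtain a b c a' b' c' where z: "z = bary p q r a b c" "in_cell h1' h1 a b c"
    "z = bary p q r a' b' c'" "in_cell h2' h2 a' b' c'"
    unfolding cell_def by blast
  then have "a = a' \<and> b = b' \<and> c = c'"
    using bary_unique[OF assms(1)] by (metis in_cell_def)
  then have z': "in_cell h1' h1 a b c" "in_cell h2' h2 a b c" using z by auto
  have "b = 0 \<and> c = 0"
  proof (rule ccontr)
    assume "\<not> ?thesis"
    then have "0 < b" "0 < c" "h2' * (2 * b + c) < c" "c \<le> h1 * (2 * b + c)"
      using z' by (auto simp: in_cell_def)
    moreover have "h1 * (2 * b + c) \<le> h2' * (2 * b + c)"
      using calculation assms(2) by (intro mult_right_mono) auto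
    ultimately show False by linarith
  qed
  then show "z \<in> {p}" using z(1) z'(1) by (auto simp: in_cell_def bary_def)
qed

text \<open>The two cells lie on opposite sides of the median, and on the median each contains only
  its own tip.\<close>

lemma cell_meet_opposite:
  assumes "nondegenerate p q r" "z \<in> cell p q r h1' h1" "z \<in> cell q p r h2' h2"
  shows "h1 = h2 \<and> z = median p q r h1"
proof -
  obtain a b c a' b' c' where z: "z = bary p q r a b c" "in_cell h1' h1 a b c"
    "z = bary q p r b' a' c'" "in_cell h2' h2 b' a' c'"
    using assms(2,3) unfolding cell_def by blast
  then have "a = a' \<and> b = b' \<and> c = c'"
    using bary_unique[OF assms(1), of a b c a' b' c'] by (auto simp: in_cell_def bary_swap)
  then have z': "in_cell h1' h1 a b c" "in_cell h2' h2 b a c" using z by auto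
  then have "a = b" "c = h1" "c = h2" "a + b + c = 1" by (auto simp: in_cell_def)
  then have "a = (1 - h1) / 2" "b = (1 - h1) / 2" "c = h1" "h1 = h2" by auto
  then show ?thesis using z(1) unfolding median_def by metis
qed

lemma cell_meet_base:
  assumes "nondegenerate p q r" "z \<in> cell p q r h' h" "z \<in> closed_segment p q"
  shows "z = p"
proof -
  obtain a b c where z: "z = bary p q r a b c" "in_cell h' h a b c"
    using assms(2) unfolding cell_def by blast
  obtain u where "z = (1 - u) *\<^sub>R p + u *\<^sub>R q" using assms(3) by (auto simp: closed_segment_def)
  then have "z = bary p q r (1 - u) u 0" by (simp add: bary_def)
  then have "c = 0"
    using bary_unique[OF assms(1), of a b c "1 - u" u 0] z by (auto simp: in_cell_def)
  then have "b = 0" "a = 1" "c = 0" using z(2) by (auto simp: in_cell_def)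
  then show ?thesis using z(1) by (simp add: bary_def)
qed

text \<open>Lets the induction recurse into a cell: the determinant is merely scaled by
  \<open>(h' - h) / 2\<close>.\<close>

lemma nondegenerate_cell:
  assumes "nondegenerate p q r" "h \<noteq> h'"
  shows "nondegenerate p (median p q r h) (median p q r h')"
proof -
  have "det2 (median p q r h - p) (median p q r h' - p) = (h' - h) / 2 * det2 (q - p) (r - p)"
    unfolding det2_def median_def bary_def by (simp add: field_simps)
  then show ?thesis using assms by (metis divide_eq_0_iff mult_eq_0_iff right_minus_eq zero_neq_numeral)
qed

lemma median_swap: "median q p r h = median p q r h"
  by (simp add: median_def bary_swap)

lemma closed_segment_subset_region: "closed_segment p q \<subseteq> region p q r"
proof
  fix z assume "z \<in> closed_segment p q"
  then obtain u where u: "z = (1 - u) *\<^sub>R p + u *\<^sub>R q" "0 \<le> u" "u \<le> 1"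
    by (auto simp: closed_segment_def)
  show "z \<in> region p q r"
  proof (cases "u = 0 \<or> u = 1")
    case True
    then show ?thesis using u by (auto simp: region_def)
  next
    case False
    then have "z = bary p q r (1 - u) u 0 \<and> 0 < 1 - u \<and> 0 < u \<and> (0::real) \<le> 0 \<and> (1 - u) + u + 0 = 1"
      using u by (simp add: bary_def)
    then show ?thesis unfolding region_def by blast
  qed
qed

lemma drawing_edge: "p \<noteq> q \<Longrightarrow> drawing {p, q} {{p, q}} (closed_segment p q)"
  unfolding drawing_def by (auto simp: segment_convex_hull[symmetric])

text \<open>Place the 40 new vertices on the median. Each edge from one of them to \<open>p\<close>
  or \<open>q\<close> is the base of a thin triangle, into which the induction hypothesis draws the
  remaining levels.\<close>

lemma rich_drawing:
  "nondegenerate p q r \<Longrightarrow>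
     \<exists>V E. drawing V E (region p q r) \<and> p \<in> V \<and> q \<in> V \<and> rich (\<lambda>x y. {x, y} \<in> E) k p q"
proof (induction k arbitrary: p q r)
  case 0
  then have "p \<noteq> q" by (auto simp: det2_def)
  then have "drawing {p, q} {{p, q}} (region p q r)"
    using drawing_mono drawing_edge closed_segment_subset_region by metis
  then show ?case by force
next
  case (Suc k)
  have "p \<noteq> q" using Suc.prems by (auto simp: det2_def)
  \<comment> \<open>\<open>h j\<close> is the height of the j-th vertex; \<open>h' j\<close> is
    halfway down to the previous one, so slope ranges for different \<open>j\<close> are
    disjoint.\<close>
  define h where "h j = real j / 41" for j :: nat
  define h' where "h' j = (real j - 1 / 2) / 41" for j :: nat
  have h: "0 < h' j" "h' j < h j" "h j < 1" if "j \<in> {1..40}" for j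
    using that by (auto simp: h_def h'_def)
  have h_le: "h i \<le> h' j" if "i < j" for i j
    using that by (auto simp: h_def h'_def)
  define w where "w j = median p q r (h j)" for j
  \<comment> \<open>\<open>None\<close> indexes the base edge, \<open>Some (j, b)\<close> the cell
    of the j-th vertex at \<open>p\<close> or \<open>q\<close>, according to
    \<open>b\<close>.\<close>
  define I where "I = insert None (Some ` ({1..40::nat} \<times> (UNIV :: bool set)))"
  define cl where "cl jb = (case jb of (j, b) \<Rightarrow>
      if b then cell p q r (h' j) (h j) else cell q p r (h' j) (h j))" for jb :: "nat \<times> bool"
  define P where "P jb V E \<longleftrightarrow> (case jb of (j, b) \<Rightarrow> drawing V E (cl (j, b)) \<and>
      (if b then p else q) \<in> V \<and> w j \<in> V \<and> rich (\<lambda>x y. {x, y} \<in> E) k (if b then p else q) (w j))"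
    for jb :: "nat \<times> bool" and V E
  have half: "\<exists>V E. drawing V E (cell p q r (h' j) (h j)) \<and> p \<in> V \<and> median p q r (h j) \<in> V \<and>
      rich (\<lambda>x y. {x, y} \<in> E) k p (median p q r (h j))"
    if "j \<in> {1..40}" "nondegenerate p q r" for j p q
    using Suc.IH[OF nondegenerate_cell[OF that(2), of "h j" "h' j"]] h[OF that(1)]
      drawing_mono[OF _ region_subset_cell[OF h[OF that(1)]]] by (metis less_irrefl)
  have "\<exists>V E. P (j, b) V E" if "j \<in> {1..40}" for j b
    using half[OF that Suc.prems] half[OF that nondegenerate_swap[OF Suc.prems]]
    by (cases b) (simp_all add: P_def cl_def w_def median_swap)
  then have "\<forall>jb \<in> {1..40} \<times> UNIV. \<exists>V E. P jb V E" by blast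
  then obtain VV EE where VE: "P (j, b) (VV (j, b)) (EE (j, b))" if "j \<in> {1..40}" for j b
    by (metis SigmaI UNIV_I)
  define V where "V = case_option {p, q} VV"
  define E where "E = case_option {{p, q}} EE"
  define R where "R = case_option (closed_segment p q) cl"
  have dr: "drawing (V i) (E i) (R i)" if "i \<in> I" for i
    using that VE \<open>p \<noteq> q\<close> drawing_edge by (auto simp: I_def V_def E_def R_def P_def)
  have VS: "(if b then p else q) \<in> V (Some (j, b))" "w j \<in> V (Some (j, b))"
    "rich (\<lambda>x y. {x, y} \<in> E (Some (j, b))) k (if b then p else q) (w j)" if "j \<in> {1..40}" for j b
    using VE[OF that, of b] by (simp_all add: V_def E_def P_def)
  note nd = Suc.prems nondegenerate_swap[OF Suc.prems]
  \<comment> \<open>Cells at the same end share only that end; cells at different ends share at most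
    a common tip \<open>w i\<close>.\<close>
  have meet_SS: "cl (i, b) \<inter> cl (j, d) \<subseteq> V (Some (i, b))"
    if "i \<in> {1..40}" "j \<in> {1..40}" "(i, b) \<noteq> (j, d)" for i j b d
  proof (cases "b = d")
    case True
    then have "i < j \<or> j < i" using that by auto
    then have "cl (i, b) \<inter> cl (j, d) \<subseteq> {if b then p else q}"
      using True cell_meet_same_side[OF nd(1)] cell_meet_same_side[OF nd(2)] h_le
      by (auto simp: cl_def) blast+
    then show ?thesis using VS(1)[OF that(1), of b] by blast
  next
    case False
    have "cl (i, b) \<inter> cl (j, d) \<subseteq> {w i}"
      using False cell_meet_opposite[OF nd(1)] cell_meet_opposite[OF nd(2)]
      by (auto simp: cl_def w_def median_swap)
    then show ?thesis using VS(2)[OF that(1), of b] by blast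
  qed
  have meet_base: "cl (j, b) \<inter> closed_segment p q \<subseteq> {if b then p else q}" for j b
    using cell_meet_base[OF nd(1)] cell_meet_base[OF nd(2)]
    by (auto simp: cl_def closed_segment_commute)
  have meet: "R i \<inter> R j \<subseteq> V i" if ij: "i \<in> I" "j \<in> I" "i \<noteq> j" for i j
  proof (cases i)
    case None
    then obtain l b where "j = Some (l, b)" using ij by (auto simp: I_def)
    then show ?thesis using None meet_base[of l b] by (auto simp: R_def V_def split: if_splits)
  next
    case (Some jb)
    then obtain l b where i: "i = Some (l, b)" by (cases jb) auto
    then have l: "l \<in> {1..40}" using ij(1) by (auto simp: I_def)
    show ?thesis
    proof (cases j)
      case None
      then show ?thesis using i meet_base[of l b] VS(1)[OF l, of b] by (auto simp: R_def)
    next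
      case (Some md)
      then obtain m d where j: "j = Some (m, d)" by (cases md) auto
      then have "m \<in> {1..40}" using ij(2) by (auto simp: I_def)
      then show ?thesis using meet_SS[of l m b d] i j l ij(3) by (simp add: R_def)
    qed
  qed
  have "drawing (\<Union>i\<in>I. V i) (\<Union>i\<in>I. E i) (\<Union>i\<in>I. R i)"
    using dr meet by (intro drawing_UN) (auto simp: I_def)
  moreover have "R i \<subseteq> region p q r" if "i \<in> I" for i
    using that by (auto simp: I_def R_def cl_def split: if_splits
      intro: subsetD[OF closed_segment_subset_region] subsetD[OF cell_subset_region]
        subsetD[OF cell_subset_region[of q p r, unfolded region_swap[of q p]]])
  then have "(\<Union>i\<in>I. R i) \<subseteq> region p q r" by blast
  ultimately have 1: "drawing (\<Union>i\<in>I. V i) (\<Union>i\<in>I. E i) (region p q r)"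
    by (rule drawing_mono)
  have "None \<in> I" by (simp add: I_def)
  then have 2: "p \<in> (\<Union>i\<in>I. V i)" "q \<in> (\<Union>i\<in>I. V i)" "{p, q} \<in> (\<Union>i\<in>I. E i)"
    by (force simp: V_def E_def)+
  have "rich (\<lambda>x y. {x, y} \<in> (\<Union>i\<in>I. E i)) k (if b then p else q) (w j)" if "j \<in> {1..40}" for j b
  proof -
    have "Some (j, b) \<in> I" using that by (auto simp: I_def)
    then show ?thesis by (intro rich_adj_mono[OF VS(3)[OF that]]) blast
  qed
  from this[of _ True] this[of _ False]
  have "\<forall>x \<in> w ` {1..40}. rich (\<lambda>x y. {x, y} \<in> (\<Union>i\<in>I. E i)) k p x \<and>
      rich (\<lambda>x y. {x, y} \<in> (\<Union>i\<in>I. E i)) k q x" by auto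
  moreover have "inj_on w {1..40}"
  proof (rule inj_onI)
    fix i j assume "w i = w j"
    then have "h i = h j"
      using bary_unique[OF nd(1), of "(1 - h i) / 2" "(1 - h i) / 2" "h i" "(1 - h j) / 2" "(1 - h j) / 2" "h j"]
      by (simp add: w_def median_def field_simps)
    then show "i = j" by (simp add: h_def)
  qed
  then have "card (w ` {1..40}) = 40" by (simp add: card_image)
  ultimately have "rich (\<lambda>x y. {x, y} \<in> (\<Union>i\<in>I. E i)) (Suc k) p q"
    unfolding rich.simps using 2 by (blast intro: finite_imageI)
  then show ?case using 1 2 by blast
qed

section \<open>Planarity and vertex orders\<close>

text \<open>The inverse of \<open>f\<close> serves as the placement, so every renamed edge is drawn
  as its original segment.\<close>

lemma drawing_planar:
  assumes "drawing V E R" "inj_on f V"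
  shows "simple_graph (f ` V) ((`) f ` E)" "planar (f ` V) ((`) f ` E)"
proof -
  have ends: "\<exists>u v. u \<in> V \<and> v \<in> V \<and> u \<noteq> v \<and> e = {u, v}"
    and EV: "convex hull e \<inter> V \<subseteq> e" if "e \<in> E" for e
    using drawingD(3,5)[OF assms(1) that] by auto
  note EE = drawingD(6)[OF assms(1)]
  have sub: "e \<subseteq> V" if "e \<in> E" for e using ends[OF that] by auto
  show "simple_graph (f ` V) ((`) f ` E)"
    unfolding simple_graph_def
  proof (intro conjI ballI)
    show "finite (f ` V)" using drawingD(1)[OF assms(1)] by simp
    fix e' assume "e' \<in> (`) f ` E"
    then obtain e where e: "e \<in> E" "e' = f ` e" by blast
    obtain u v where uv: "u \<in> V" "v \<in> V" "u \<noteq> v" "e = {u, v}" using ends[OF e(1)] by blast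
    then have "f u \<noteq> f v" using assms(2) by (meson inj_onD)
    then show "\<exists>u v. u \<in> f ` V \<and> v \<in> f ` V \<and> u \<noteq> v \<and> e' = {u, v}"
      using uv e by auto
  qed
  define pos where "pos = inv_into V f"
  have pos: "pos ` f ` A = A" if "A \<subseteq> V" for A
    using that assms(2) unfolding pos_def by (simp add: inv_into_image_cancel)
  have "\<forall>e\<in>(`) f ` E. \<exists>g. arc g \<and> {pathstart g, pathfinish g} = pos ` e \<and>
      path_image g = convex hull (pos ` e)"
  proof
    fix e' assume "e' \<in> (`) f ` E"
    then obtain e where e: "e \<in> E" "e' = f ` e" by blast
    obtain u v where "u \<noteq> v" "e = {u, v}" using ends[OF e(1)] by blast
    then show "\<exists>g. arc g \<and> {pathstart g, pathfinish g} = pos ` e' \<and> path_image g = convex hull (pos ` e')"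
      using pos[OF sub[OF e(1)]] e
      by (intro exI[of _ "linepath u v"]) (simp add: arc_linepath segment_convex_hull)
  qed
  then obtain c where c: "\<And>e. e \<in> (`) f ` E \<Longrightarrow> arc (c e) \<and>
      {pathstart (c e), pathfinish (c e)} = pos ` e \<and> path_image (c e) = convex hull (pos ` e)"
    by metis
  show "planar (f ` V) ((`) f ` E)"
    unfolding planar_def
  proof (intro exI[of _ pos] exI[of _ c] conjI ballI impI)
    show "inj_on pos (f ` V)" unfolding pos_def by (simp add: inj_on_inv_into)
    fix e' assume e': "e' \<in> (`) f ` E"
    then obtain e where e: "e \<in> E" "e' = f ` e" by blast
    have pe: "pos ` e' = e" using pos[OF sub[OF e(1)]] e by simp
    show "arc (c e')" "{pathstart (c e'), pathfinish (c e')} = pos ` e'" using c[OF e'] by auto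
    show "path_image (c e') \<inter> pos ` f ` V = pos ` e'"
      using c[OF e'] pe pos[of V] EV[OF e(1)] sub[OF e(1)] hull_subset[of e convex] by auto
    fix d' assume d': "d' \<in> (`) f ` E" "e' \<noteq> d'"
    then obtain d where d: "d \<in> E" "d' = f ` d" by blast
    then have "e \<noteq> d" using d'(2) e by blast
    have pd: "pos ` d' = d" using pos[OF sub[OF d(1)]] d by simp
    have "e' \<inter> d' = f ` (e \<inter> d)"
      using inj_on_image_Int[OF assms(2) sub[OF e(1)] sub[OF d(1)]] e d by simp
    then have "pos ` (e' \<inter> d') = e \<inter> d" using pos[of "e \<inter> d"] sub[OF e(1)] by auto
    then show "path_image (c e') \<inter> path_image (c d') \<subseteq> pos ` (e' \<inter> d')"
      using c[OF e'] c[OF d'(1)] pe pd EE[OF e(1) d(1) \<open>e \<noteq> d\<close>] by simp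
  qed
qed

text \<open>The rank counts predecessors. Transitivity makes it strictly monotone, and totality
  gives the converse.\<close>

lemma rank_exists:
  assumes "finite V" "strict_linear_order_on V r"
  obtains \<rho> :: "'a \<Rightarrow> int" where "inj_on \<rho> V"
    "\<And>x y. x \<in> V \<Longrightarrow> y \<in> V \<Longrightarrow> \<rho> x < \<rho> y \<Longrightarrow> (x, y) \<in> r"
proof -
  define \<rho> where "\<rho> x = int (card {y \<in> V. (y, x) \<in> r})" for x
  have "trans r" "irrefl r" "total_on V r"
    using assms(2) by (auto simp: strict_linear_order_on_def)
  have mono: "\<rho> x < \<rho> y" if "x \<in> V" "(x, y) \<in> r" for x y
  proof -
    have "{z \<in> V. (z, x) \<in> r} \<subset> {z \<in> V. (z, y) \<in> r}"
      using that \<open>trans r\<close> \<open>irrefl r\<close> by (auto simp: irrefl_def dest: transD)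
    then show ?thesis unfolding \<rho>_def using assms(1) by (simp add: psubset_card_mono)
  qed
  have tot: "x = y \<or> (x, y) \<in> r \<or> (y, x) \<in> r" if "x \<in> V" "y \<in> V" for x y
    using that \<open>total_on V r\<close> by (auto simp: total_on_def)
  show thesis
  proof (rule that[of \<rho>])
    show "inj_on \<rho> V"
      by (rule inj_onI) (metis mono tot less_irrefl)
    show "(x, y) \<in> r" if "x \<in> V" "y \<in> V" "\<rho> x < \<rho> y" for x y
      using that tot[of x y] mono[of y x] by fastforce
  qed
qed

lemma rich_no_layout:
  assumes "simple_graph V E" "rich (\<lambda>x y. {x, y} \<in> E) 6 u v"
  shows "\<not> has_mixed_1s1q_layout V E"
proof
  assume "has_mixed_1s1q_layout V E"
  then obtain r S Q where r: "strict_linear_order_on V r" and SQ: "S \<union> Q = E"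
    and st: "is_stack r S" and qu: "is_queue r Q"
    unfolding has_mixed_1s1q_layout_def by blast
  have fin: "finite V" and ends: "\<And>e. e \<in> E \<Longrightarrow> \<exists>u v. u \<in> V \<and> v \<in> V \<and> u \<noteq> v \<and> e = {u, v}"
    using assms(1) unfolding simple_graph_def by blast+
  obtain \<rho> :: "'a \<Rightarrow> int" where inj: "inj_on \<rho> V"
    and less: "\<And>x y. x \<in> V \<Longrightarrow> y \<in> V \<Longrightarrow> \<rho> x < \<rho> y \<Longrightarrow> (x, y) \<in> r"
    using rank_exists[OF fin r] by blast
  have pair: "x \<in> V" "y \<in> V" "x \<noteq> y" if "{x, y} \<in> E" for x y
    using ends[OF that] by (auto simp: doubleton_eq_iff)
  \<comment> \<open>The edges of \<open>T\<close> carried over to ranks; unordered edges make the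
    relation symmetric.\<close>
  define img where "img T a b \<longleftrightarrow> (\<exists>x\<in>V. \<exists>y\<in>V. a = \<rho> x \<and> b = \<rho> y \<and> {x, y} \<in> T)" for T a b
  have img_sym: "img T b a" if "img T a b" for T a b
    using that unfolding img_def by (metis insert_commute)
  have img_irrefl: "\<not> img T a a" if "T \<subseteq> E" for T a
    using that inj pair(3) unfolding img_def by (metis inj_onD subsetD)
  interpret layout "img S" "img Q"
  proof
    fix a b c d
    assume *: "a < c" "c < b" "b < d" "img S a b" "img S c d"
    then obtain x y z t where "{x, y, z, t} \<subseteq> V" "a = \<rho> x" "b = \<rho> y" "c = \<rho> z" "d = \<rho> t"
      "{x, y} \<in> S" "{z, t} \<in> S" unfolding img_def by blast
    moreover from this * have "(x, z) \<in> r" "(z, y) \<in> r" "(y, t) \<in> r" by (auto intro: less)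
    ultimately show False using st unfolding is_stack_def edges_cross_def by blast
  next
    fix a b c d
    assume *: "a < c" "c < d" "d < b" "img Q a b" "img Q c d"
    then obtain x y z t where "{x, y, z, t} \<subseteq> V" "a = \<rho> x" "b = \<rho> y" "c = \<rho> z" "d = \<rho> t"
      "{x, y} \<in> Q" "{z, t} \<in> Q" unfolding img_def by blast
    moreover from this * have "(x, z) \<in> r" "(z, t) \<in> r" "(t, y) \<in> r" by (auto intro: less)
    ultimately show False using qu unfolding is_queue_def edges_nest_def by blast
  qed (use img_sym img_irrefl SQ in auto)
  have "rich adj 6 (\<rho> u) (\<rho> v)"
  proof (rule rich_map[OF assms(2) inj])
    fix x y assume xy: "{x, y} \<in> E"
    show "x \<in> V \<and> y \<in> V \<and> adj (\<rho> x) (\<rho> y)"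
      using pair[OF xy] xy SQ unfolding adj_def img_def by blast
  qed
  then show False using not_rich by blast
qed

theorem theorem1:
  shows "\<exists>(V :: nat set) (E :: nat set set).
           simple_graph V E \<and> planar V E \<and> \<not> has_mixed_1s1q_layout V E"
proof -
  \<comment> \<open>Any nondegenerate triangle would do as the outer frame.\<close>
  have "nondegenerate 0 1 \<i>" by (simp add: det2_def)
  then obtain V E where dr: "drawing V E (region 0 1 \<i>)" and ri: "rich (\<lambda>x y. {x, y} \<in> E) 6 0 1"
    using rich_drawing by blast
  have "finite V" by (rule drawingD(1)[OF dr])
  then obtain f :: "complex \<Rightarrow> nat" where inj: "inj_on f V"
    using finite_imp_inj_to_nat_seg by blast
  have "rich (\<lambda>x y. {x, y} \<in> (`) f ` E) 6 (f 0) (f 1)"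
  proof (rule rich_map[OF ri inj])
    fix x y assume xy: "{x, y} \<in> E"
    then have "{x, y} \<subseteq> V" using drawingD(3)[OF dr xy] by (auto simp: doubleton_eq_iff)
    moreover have "f ` {x, y} \<in> (`) f ` E" using xy by (rule imageI)
    ultimately show "x \<in> V \<and> y \<in> V \<and> {f x, f y} \<in> (`) f ` E" by simp
  qed
  then have "\<not> has_mixed_1s1q_layout (f ` V) ((`) f ` E)"
    by (rule rich_no_layout[OF drawing_planar(1)[OF dr inj]])
  with drawing_planar[OF dr inj] show ?thesis by blast
qed

end
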